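(* For any infinite cardinal $\lambda$, there is a suitable bi-graph of size $\lambda$.
   Context: A bi-graph (or $2$-graph, $2$-edge-labeled graph) is a triple $\mathbf B=\langle B,R_0,R_1\rangle$ where $R_0,R_1$ are irreflexive symmetric relations on $B$ and $R_0\cap R_1=\emptyset$. A partial function (coloring) $\eta$ from $B$ into $2=\{0,1\}$ respects $\mathbf B$ if $\{\eta(a),\eta(b)\}\ne\{e\}$ whenever $e\in\{0,1\}$, $a,b\in\mathrm{dom}(\eta)$ and $a\mathrel{R_e}b$. For an infinite cardinal $\lambda$, $\mathbf B$ is a suitable bi-graph of size $\lambda$ if it is a bi-graph such that: (iii) for each $e\in\{0,1\}$ there is $W_e\subseteq B$ which is a complete $R_e$-graph (i.e. any two distinct elements of $W_e$ are $R_e$-related); (iv) $W_0\cap W_1=\emptyset$ and $|B|=|W_0|=|W_1|=\lambda$; (v) for any $a\in B$ and $e\in\{0,1\}$ there is a coloring $\eta:B\to\{0,1\}$ respecting $\mathbf B$ with $\eta(a)=e$; (vi) for any $a,b\in B$ there is an automorphism $f$ of $\mathbf B$ (a bijection of $B$ preserving $R_0$ and $R_1$ in both directions) with $f(a)=b$. *)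

theory Defs
  imports Main
begin

unbundle cardinal_syntax

text \<open>
  The label and colour set \<open>2 = {0, 1}\<close> is rendered as \<^typ>\<open>bool\<close>, with \<^term>\<open>False\<close>
  for \<open>0\<close> and \<^term>\<open>True\<close> for \<open>1\<close>.
\<close>

record 'a bigraph =
  verts :: "'a set"
  rel0 :: "'a rel"
  rel1 :: "'a rel"

definition edge_rel :: "'a bigraph \<Rightarrow> bool \<Rightarrow> 'a rel" where
  "edge_rel B e = (if e then rel1 B else rel0 B)"

definition is_bigraph :: "'a bigraph \<Rightarrow> bool" where
  "is_bigraph B \<longleftrightarrow>
     (\<forall>e. edge_rel B e \<subseteq> verts B \<times> verts B \<and> irrefl (edge_rel B e) \<and> sym (edge_rel B e)) \<and>
     rel0 B \<inter> rel1 B = {}"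

definition respects_bigraph :: "('a \<rightharpoonup> bool) \<Rightarrow> 'a bigraph \<Rightarrow> bool" where
  "respects_bigraph \<eta> B \<longleftrightarrow>
     dom \<eta> \<subseteq> verts B \<and>
     (\<forall>e. \<forall>a\<in>dom \<eta>. \<forall>b\<in>dom \<eta>. (a, b) \<in> edge_rel B e \<longrightarrow> {the (\<eta> a), the (\<eta> b)} \<noteq> {e})"

definition complete_on :: "'a rel \<Rightarrow> 'a set \<Rightarrow> bool" where
  "complete_on R W \<longleftrightarrow> (\<forall>a\<in>W. \<forall>b\<in>W. a \<noteq> b \<longrightarrow> (a, b) \<in> R)"

definition bigraph_automorphism :: "'a bigraph \<Rightarrow> ('a \<Rightarrow> 'a) \<Rightarrow> bool" where
  "bigraph_automorphism B f \<longleftrightarrow>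
     bij_betw f (verts B) (verts B) \<and>
     (\<forall>e. \<forall>a\<in>verts B. \<forall>b\<in>verts B. (a, b) \<in> edge_rel B e \<longleftrightarrow> (f a, f b) \<in> edge_rel B e)"

text \<open>
  A cardinal is a cardinal-order relation \<open>r\<close>; a set \<open>A\<close> has that cardinality iff \<open>|A| =o r\<close>.
\<close>

definition suitable_bigraph :: "'b rel \<Rightarrow> 'a bigraph \<Rightarrow> bool" where
  "suitable_bigraph r B \<longleftrightarrow>
     is_bigraph B \<and>
     (\<exists>W :: bool \<Rightarrow> 'a set.
        (\<forall>e. W e \<subseteq> verts B \<and> complete_on (edge_rel B e) (W e)) \<and>
        W False \<inter> W True = {} \<and>
        |verts B| =o r \<and> (\<forall>e. |W e| =o r)) \<and>
     (\<forall>a\<in>verts B. \<forall>e. \<exists>\<eta>. dom \<eta> = verts B \<and> respects_bigraph \<eta> B \<and> \<eta> a = Some e) \<and>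
     (\<forall>a\<in>verts B. \<forall>b\<in>verts B. \<exists>f. bigraph_automorphism B f \<and> f a = b)"

end

theory Submission
  imports Defs
begin

text \<open>
  The bi-graph lives on the Cayley graph of a free product of two-element groups, which is a regular
  tree.  Take generators \<open>(e, x)\<close>, where \<open>e\<close> is a label and \<open>x\<close> ranges over a set \<open>A\<close> of size
  \<open>\<lambda>\<close>, each of them an involution and with no further relations; the group elements are the words
  without two equal adjacent letters.  Letters are multiplied in at the head of a word, and two
  vertices are \<open>R\<^sub>e\<close>-related iff they are the neighbours of a common vertex along two distinct
  generators of label \<open>e\<close>.  The neighbours of a vertex along all generators of label \<open>e\<close> then form
  a complete \<open>R\<^sub>e\<close>-graph of size \<open>\<lambda>\<close>; around the empty word these are the one-letter words.

  Colour a word whose head has label \<open>e\<close> by the opposite of \<open>e\<close>.  A vertex has at most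
  one neighbour that is closer to the empty word, and all others arise by adding a letter at the
  head.  So among the neighbours of a vertex along label \<open>e\<close> at most one has colour \<open>e\<close>, which is
  what respecting the bi-graph demands (\<open>respects_head_colour\<close>).  The empty word has no head
  and may take either colour.

  Multiplying at the other end of the word commutes with multiplying at the head
  (\<open>flip_head_flip_last\<close>), so these maps are automorphisms, and they carry the empty word to every
  vertex.  Transitivity follows, and with it the colour of any vertex can be prescribed.  As
  there are \<open>\<lambda>\<close> finite words, the bi-graph has the right size, and an injection moves it to any given
  type that is large enough (\<open>suitable_transport\<close>).
\<close>

section \<open>The free product of involutions\<close>

definition flip_head :: "'l \<Rightarrow> 'l list \<Rightarrow> 'l list" where
  "flip_head l w = (if w \<noteq> [] \<and> hd w = l then tl w else l # w)"

definition flip_last :: "'l \<Rightarrow> 'l list \<Rightarrow> 'l list" where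
  "flip_last l w = (if w \<noteq> [] \<and> last w = l then butlast w else w @ [l])"

definition reduced_words :: "'l set \<Rightarrow> 'l list set" where
  "reduced_words L = {w \<in> lists L. distinct_adj w}"

lemma flip_head_Nil [simp]: "flip_head l [] = [l]"
  by (simp add: flip_head_def)

lemma flip_head_Cons [simp]: "flip_head l (k # w) = (if k = l then w else l # k # w)"
  by (simp add: flip_head_def)

lemma flip_last_Nil [simp]: "flip_last l [] = [l]"
  by (simp add: flip_last_def)

lemma flip_last_snoc [simp]: "flip_last l (w @ [k]) = (if k = l then w else w @ [k, l])"
  by (simp add: flip_last_def)

lemma Nil_in_reduced_words [simp]: "[] \<in> reduced_words L"
  by (simp add: reduced_words_def)

lemma flip_head_in_reduced_words:
  "l \<in> L \<Longrightarrow> w \<in> reduced_words L \<Longrightarrow> flip_head l w \<in> reduced_words L"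
  by (cases w) (auto simp: reduced_words_def dest: distinct_adj_ConsD)

lemma flip_last_in_reduced_words:
  "l \<in> L \<Longrightarrow> w \<in> reduced_words L \<Longrightarrow> flip_last l w \<in> reduced_words L"
  by (cases w rule: rev_cases) (auto simp: reduced_words_def distinct_adj_append_iff)

lemma flip_head_flip_head:
  "w \<in> reduced_words L \<Longrightarrow> flip_head l (flip_head l w) = w"
  by (cases w; cases "tl w") (auto simp: reduced_words_def)

lemma flip_last_flip_last:
  assumes "w \<in> reduced_words L"
  shows "flip_last l (flip_last l w) = w"
proof (cases w rule: rev_cases)
  case (snoc v k)
  with assms have "v = [] \<or> last v \<noteq> k"
    by (auto simp: reduced_words_def distinct_adj_append_iff)
  with snoc show ?thesis
    using flip_last_snoc[of l "v @ [k]" l] by (auto simp: flip_last_def)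
qed (simp add: flip_last_def)

text \<open>
  Left and right multiplication commute.  The two ends of the word can only interfere when it has
  at most one letter.
\<close>

lemma flip_head_flip_last: "flip_head l (flip_last k w) = flip_last k (flip_head l w)"
  by (cases w; cases "tl w") (auto simp: flip_head_def flip_last_def)

text \<open>The group acts freely on itself; this makes the relations below irreflexive.\<close>

lemma flip_head_inject: "flip_head l w = flip_head k w \<Longrightarrow> l = k"
proof (cases w)
  case (Cons h t)
  have "t \<noteq> k # h # t" "l # h # t \<noteq> t"
    by (auto dest: arg_cong[of _ _ length])
  then show "flip_head l w = flip_head k w \<Longrightarrow> l = k"
    by (simp add: Cons split: if_splits)
qed simp

section \<open>The bi-graph on reduced words\<close>

definition two_step_rel :: "'a set \<Rightarrow> bool \<Rightarrow> (bool \<times> 'a) list rel" where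
  "two_step_rel A e =
     {(w, flip_head (e, y) (flip_head (e, x) w)) | w x y.
        w \<in> reduced_words (UNIV \<times> A) \<and> x \<in> A \<and> y \<in> A \<and> x \<noteq> y}"

definition word_bigraph :: "'a set \<Rightarrow> (bool \<times> 'a) list bigraph" where
  "word_bigraph A =
     \<lparr>verts = reduced_words (UNIV \<times> A), rel0 = two_step_rel A False, rel1 = two_step_rel A True\<rparr>"

lemma verts_word_bigraph [simp]: "verts (word_bigraph A) = reduced_words (UNIV \<times> A)"
  by (simp add: word_bigraph_def)

lemma edge_rel_word_bigraph [simp]: "edge_rel (word_bigraph A) e = two_step_rel A e"
  by (simp add: word_bigraph_def edge_rel_def)

lemma sym_two_step_rel: "sym (two_step_rel A e)"
proof (rule symI)
  fix v w
  assume "(v, w) \<in> two_step_rel A e"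
  then obtain x y where *: "v \<in> reduced_words (UNIV \<times> A)" "x \<in> A" "y \<in> A" "x \<noteq> y"
    and w: "w = flip_head (e, y) (flip_head (e, x) v)"
    by (auto simp: two_step_rel_def)
  have mid: "flip_head (e, x) v \<in> reduced_words (UNIV \<times> A)"
    using * by (simp add: flip_head_in_reduced_words)
  have "w \<in> reduced_words (UNIV \<times> A)"
    unfolding w using * mid by (simp add: flip_head_in_reduced_words)
  moreover have "v = flip_head (e, x) (flip_head (e, y) w)"
    unfolding w using *(1) mid by (simp add: flip_head_flip_head)
  ultimately show "(w, v) \<in> two_step_rel A e"
    using * unfolding two_step_rel_def by blast
qed

lemma irrefl_two_step_rel: "irrefl (two_step_rel A e)"
proof (rule irreflI, rule notI)
  fix w
  assume "(w, w) \<in> two_step_rel A e"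
  then obtain x y where w: "w \<in> reduced_words (UNIV \<times> A)" and "x \<noteq> y"
    and *: "w = flip_head (e, y) (flip_head (e, x) w)" and xy: "x \<in> A" "y \<in> A"
    by (auto simp: two_step_rel_def)
  have "flip_head (e, x) w \<in> reduced_words (UNIV \<times> A)"
    using w xy by (simp add: flip_head_in_reduced_words)
  then have "flip_head (e, y) w = flip_head (e, x) w"
    by (rule trans[OF arg_cong[OF *, of "flip_head (e, y)"] flip_head_flip_head])
  then have "(e, y) = (e, x)"
    by (rule flip_head_inject)
  with \<open>x \<noteq> y\<close> show False
    by simp
qed

text \<open>
  In a tree, two vertices at distance two have only one common neighbour, which fixes the
  generators on the path between them.  In terms of words, two steps add two letters unless the
  first one removes the head, so a path that starts by removing the head ends in a shorter word
  than any path that does not.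
\<close>

lemma flip_head_two_step_unique:
  assumes eq: "flip_head l' (flip_head l w) = flip_head k' (flip_head k w)"
    and "l \<noteq> l'" "k \<noteq> k'"
  shows "l = k"
proof (rule ccontr)
  assume "l \<noteq> k"
  have grow: "flip_head b (flip_head a w) = b # a # w" if "a \<noteq> b" "w = [] \<or> hd w \<noteq> a" for a b
    using that by (cases w) auto
  have shrink: "length (flip_head b (flip_head a w)) \<le> length w" if "w \<noteq> []" "hd w = a" for a b
    using that by (cases w) (auto simp: flip_head_def)
  consider "w \<noteq> []" "hd w = l" | "w \<noteq> []" "hd w = k" | "w = [] \<or> hd w \<noteq> l" "w = [] \<or> hd w \<noteq> k"
    by blast
  then show False
  proof cases
    case 1
    then show False
      using shrink[of l l'] grow[of k k'] assms \<open>l \<noteq> k\<close> by simp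
  next
    case 2
    then show False
      using shrink[of k k'] grow[of l l'] assms \<open>l \<noteq> k\<close> by simp
  next
    case 3
    then show False
      using grow[of l l'] grow[of k k'] assms \<open>l \<noteq> k\<close> by simp
  qed
qed

lemma is_bigraph_word_bigraph: "is_bigraph (word_bigraph A)"
proof -
  have "two_step_rel A e \<subseteq> reduced_words (UNIV \<times> A) \<times> reduced_words (UNIV \<times> A)" for e
    by (auto simp: two_step_rel_def flip_head_in_reduced_words)
  moreover have "two_step_rel A False \<inter> two_step_rel A True = {}"
    by (auto simp: two_step_rel_def dest: flip_head_two_step_unique)
  ultimately show ?thesis
    unfolding is_bigraph_def
    by (simp add: sym_two_step_rel irrefl_two_step_rel) (simp add: word_bigraph_def)
qed

lemma complete_on_singleton_words:
  "complete_on (two_step_rel A e) ((\<lambda>x. [(e, x)]) ` A)"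
proof -
  have "([(e, x)], [(e, y)]) \<in> two_step_rel A e" if "x \<in> A" "y \<in> A" "x \<noteq> y" for x y
  proof -
    have "[(e, x)] \<in> reduced_words (UNIV \<times> A)"
      using that by (simp add: reduced_words_def)
    moreover have "[(e, y)] = flip_head (e, y) (flip_head (e, x) [(e, x)])"
      by simp
    ultimately show ?thesis
      using that unfolding two_step_rel_def by blast
  qed
  then show ?thesis
    by (auto simp: complete_on_def)
qed

section \<open>Colourings\<close>

definition head_colour :: "bool \<Rightarrow> (bool \<times> 'a) list \<Rightarrow> bool" where
  "head_colour c w = (if w = [] then c else \<not> fst (hd w))"

text \<open>
  If \<open>w\<close> has colour \<open>e\<close> then its head does not have label \<open>e\<close>, so walking along two distinct
  generators of label \<open>e\<close> adds two letters and ends in a word with a head of label \<open>e\<close>.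
\<close>

lemma head_colour_two_step:
  assumes "(v, w) \<in> two_step_rel A e" "head_colour c v = e"
  shows "head_colour c w \<noteq> e"
proof -
  obtain x y where w: "w = flip_head (e, y) (flip_head (e, x) v)" and "x \<noteq> y"
    using assms(1) by (auto simp: two_step_rel_def)
  moreover have "flip_head (e, x) v = (e, x) # v"
    using assms(2) by (cases v) (auto simp: head_colour_def)
  ultimately have "w = (e, y) # (e, x) # v"
    by simp
  then show ?thesis
    by (simp add: head_colour_def)
qed

lemma respects_head_colour:
  assumes "dom \<eta> = verts (word_bigraph A)"
    and "\<And>w. w \<in> verts (word_bigraph A) \<Longrightarrow> the (\<eta> w) = head_colour c w"
  shows "respects_bigraph \<eta> (word_bigraph A)"
proof -
  have "{the (\<eta> v), the (\<eta> w)} \<noteq> {e}"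
    if "v \<in> dom \<eta>" "w \<in> dom \<eta>" "(v, w) \<in> edge_rel (word_bigraph A) e" for v w e
  proof -
    have "the (\<eta> v) = head_colour c v" "the (\<eta> w) = head_colour c w"
      using that assms by auto
    then show ?thesis
      using head_colour_two_step[of v w A e c] that(3) by (auto simp: doubleton_eq_iff)
  qed
  then show ?thesis
    using assms(1) by (simp add: respects_bigraph_def)
qed

section \<open>Automorphisms\<close>

lemma bigraph_automorphism_verts:
  "bigraph_automorphism B f \<Longrightarrow> a \<in> verts B \<Longrightarrow> f a \<in> verts B"
  unfolding bigraph_automorphism_def by (rule bij_betw_apply) (rule conjunct1)

lemma bigraph_automorphism_edge:
  assumes "bigraph_automorphism B f" "a \<in> verts B" "b \<in> verts B"
  shows "(f a, f b) \<in> edge_rel B e \<longleftrightarrow> (a, b) \<in> edge_rel B e"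
proof -
  have "\<forall>e. \<forall>a\<in>verts B. \<forall>b\<in>verts B. (a, b) \<in> edge_rel B e \<longleftrightarrow> (f a, f b) \<in> edge_rel B e"
    using assms(1) unfolding bigraph_automorphism_def by (rule conjunct2)
  with assms(2,3) show ?thesis
    by blast
qed

lemma bigraph_automorphism_comp:
  assumes f: "bigraph_automorphism B f" and g: "bigraph_automorphism B g"
  shows "bigraph_automorphism B (g \<circ> f)"
proof -
  have "bij_betw (g \<circ> f) (verts B) (verts B)"
    using f g unfolding bigraph_automorphism_def by (elim conjE) (rule bij_betw_trans)
  then show ?thesis
    unfolding bigraph_automorphism_def
    by (simp add: bigraph_automorphism_verts[OF f] bigraph_automorphism_edge[OF f]
        bigraph_automorphism_edge[OF g])
qed

lemma bigraph_automorphism_id: "bigraph_automorphism B id"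
  by (simp add: bigraph_automorphism_def)

text \<open>
  The empty word can take either colour; an automorphism that sends another vertex to it passes this
  freedom on.
\<close>

lemma respects_bigraph_pullback:
  assumes f: "bigraph_automorphism B f" and \<eta>: "dom \<eta> = verts B" "respects_bigraph \<eta> B"
  shows "respects_bigraph (\<lambda>w. if w \<in> verts B then \<eta> (f w) else None) B"
proof -
  have dom: "dom (\<lambda>w. if w \<in> verts B then \<eta> (f w) else None) = verts B"
    using \<eta>(1) bigraph_automorphism_verts[OF f] by (fastforce split: if_splits)
  have "{the (\<eta> (f v)), the (\<eta> (f w))} \<noteq> {e}"
    if "v \<in> verts B" "w \<in> verts B" "(v, w) \<in> edge_rel B e" for v w e
  proof -
    have "f v \<in> dom \<eta>" "f w \<in> dom \<eta>" "(f v, f w) \<in> edge_rel B e"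
      using that \<eta>(1)
      by (simp_all add: bigraph_automorphism_verts[OF f] bigraph_automorphism_edge[OF f])
    then show ?thesis
      using \<eta>(2) unfolding respects_bigraph_def by blast
  qed
  then show ?thesis
    unfolding respects_bigraph_def dom by simp
qed

lemma flip_last_two_step:
  assumes "(v, w) \<in> two_step_rel A e" "k \<in> UNIV \<times> A"
  shows "(flip_last k v, flip_last k w) \<in> two_step_rel A e"
proof -
  obtain x y where *: "v \<in> reduced_words (UNIV \<times> A)" "x \<in> A" "y \<in> A" "x \<noteq> y"
    and w: "w = flip_head (e, y) (flip_head (e, x) v)"
    using assms(1) by (auto simp: two_step_rel_def)
  have "flip_last k w = flip_head (e, y) (flip_head (e, x) (flip_last k v))"
    by (simp add: w flip_head_flip_last)
  moreover have "flip_last k v \<in> reduced_words (UNIV \<times> A)"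
    using * assms(2) by (simp add: flip_last_in_reduced_words)
  ultimately show ?thesis
    using * unfolding two_step_rel_def by blast
qed

lemma bigraph_automorphism_flip_last:
  assumes k: "k \<in> UNIV \<times> A"
  shows "bigraph_automorphism (word_bigraph A) (flip_last k)"
proof -
  let ?V = "reduced_words (UNIV \<times> A)"
  have "bij_betw (flip_last k) ?V ?V"
    by (rule bij_betw_byWitness[where f' = "flip_last k"])
      (use flip_last_in_reduced_words[OF k] in \<open>auto simp: flip_last_flip_last\<close>)
  moreover have "(v, w) \<in> two_step_rel A e \<longleftrightarrow> (flip_last k v, flip_last k w) \<in> two_step_rel A e"
    if "v \<in> ?V" "w \<in> ?V" for v w e
    using flip_last_two_step[OF _ k] that by (metis flip_last_flip_last)
  ultimately show ?thesis
    by (simp add: bigraph_automorphism_def)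
qed

text \<open>
  A word is built up, and taken apart, letter by letter from its end.  Both directions are
  recorded, so that any two vertices are linked through the empty word.
\<close>

lemma automorphisms_link_Nil:
  assumes "w \<in> reduced_words (UNIV \<times> A)"
  shows "(\<exists>f. bigraph_automorphism (word_bigraph A) f \<and> f w = []) \<and>
         (\<exists>g. bigraph_automorphism (word_bigraph A) g \<and> g [] = w)"
  using assms
proof (induction w rule: rev_induct)
  case Nil
  show ?case
    using bigraph_automorphism_id[of "word_bigraph A"] by auto
next
  case (snoc k w)
  have k: "k \<in> UNIV \<times> A" and w: "w \<in> reduced_words (UNIV \<times> A)"
    and last: "w = [] \<or> last w \<noteq> k"
    using snoc.prems by (auto simp: reduced_words_def distinct_adj_append_iff)
  obtain f g where f: "bigraph_automorphism (word_bigraph A) f" "f w = []"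
    and g: "bigraph_automorphism (word_bigraph A) g" "g [] = w"
    using snoc.IH[OF w] by blast
  have "(f \<circ> flip_last k) (w @ [k]) = []" "(flip_last k \<circ> g) [] = w @ [k]"
    using f(2) g(2) last by (auto simp: flip_last_def)
  then show ?case
    using bigraph_automorphism_comp[OF bigraph_automorphism_flip_last[OF k] f(1)]
      bigraph_automorphism_comp[OF g(1) bigraph_automorphism_flip_last[OF k]]
    by blast
qed

section \<open>Cardinality\<close>

lemma finite_ordLeq_Cinfinite: "Cinfinite r \<Longrightarrow> finite F \<Longrightarrow> |F| \<le>o r"
  by (intro ordLess_imp_ordLeq Cfinite_ordLess_Cinfinite conjI card_of_Card_order)
    (simp_all add: cfinite_def Field_card_of)

text \<open>
  The words of each fixed length number at most \<open>r\<close>, since \<open>r\<close> absorbs finite products, and there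
  are only countably many lengths.
\<close>

lemma card_of_lists_ordLeq:
  assumes r: "Cinfinite r" and L: "|L| \<le>o r"
  shows "|lists L| \<le>o r"
proof -
  let ?F = "\<lambda>n. {w \<in> lists L. length w = n}"
  have "|?F n| \<le>o r" for n
  proof (induction n)
    case 0
    have "finite (?F 0)"
      by simp
    with r show ?case
      by (rule finite_ordLeq_Cinfinite)
  next
    case (Suc n)
    have "?F (Suc n) \<subseteq> (\<lambda>(x, w). x # w) ` (L \<times> ?F n)"
      by (auto simp: length_Suc_conv)
    then have "|?F (Suc n)| \<le>o |L \<times> ?F n|"
      by (rule surj_imp_ordLeq)
    moreover have "|L \<times> ?F n| \<le>o r"
      using r by (intro card_of_Times_ordLeq_infinite_Field L Suc.IH) (simp_all add: cinfinite_def)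
    ultimately show ?case
      by (rule ordLeq_transitive)
  qed
  then have slices: "\<forall>n\<in>UNIV. |?F n| \<le>o r"
    by (rule ballI)
  have nat: "|UNIV :: nat set| \<le>o r"
    by (rule ordIso_ordLeq_trans[OF card_of_nat natLeq_ordLeq_cinfinite[OF r]])
  have "lists L = (\<Union>n. ?F n)"
    by auto
  then show ?thesis
    using UNION_Cinfinite_bound[OF nat slices r] by simp
qed

lemma card_of_singleton_words: "|(\<lambda>x. [(e, x)]) ` A| =o |A|"
  by (rule ordIso_symmetric, rule card_of_ordIsoI[where f = "\<lambda>x. [(e, x)]"])
    (auto simp: bij_betw_def inj_on_def)

lemma card_of_reduced_words:
  assumes r: "Cinfinite r" and A: "|A| =o r"
  shows "|reduced_words (UNIV \<times> A) :: (bool \<times> 'a) list set| =o r"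
proof -
  have "|UNIV :: bool set| \<le>o r"
    using r by (simp add: finite_ordLeq_Cinfinite)
  then have "|(UNIV :: bool set) \<times> A| \<le>o r"
    using r A by (simp add: card_of_Times_ordLeq_infinite_Field cinfinite_def ordIso_imp_ordLeq)
  with r have "|lists ((UNIV :: bool set) \<times> A)| \<le>o r"
    by (rule card_of_lists_ordLeq)
  moreover have "reduced_words ((UNIV :: bool set) \<times> A) \<subseteq> lists (UNIV \<times> A)"
    by (auto simp: reduced_words_def)
  then have "|reduced_words ((UNIV :: bool set) \<times> A)| \<le>o |lists ((UNIV :: bool set) \<times> A)|"
    by (rule card_of_mono1)
  ultimately have "|reduced_words ((UNIV :: bool set) \<times> A)| \<le>o r"
    by (rule ordLeq_transitive[rotated])
  moreover have "(\<lambda>x. [(True, x)]) ` A \<subseteq> reduced_words (UNIV \<times> A)"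
    by (auto simp: reduced_words_def)
  then have "r \<le>o |reduced_words ((UNIV :: bool set) \<times> A)|"
    by (rule ordIso_ordLeq_trans[OF ordIso_symmetric[OF ordIso_transitive[OF
            card_of_singleton_words A]] card_of_mono1])
  ultimately show ?thesis
    by (simp add: ordIso_iff_ordLeq)
qed

section \<open>Suitability\<close>

lemma suitable_word_bigraph:
  assumes r: "Cinfinite r" and A: "|A| =o r"
  shows "suitable_bigraph r (word_bigraph A)"
proof -
  let ?B = "word_bigraph A"
  let ?W = "\<lambda>e. (\<lambda>x. [(e, x)]) ` A"
  have "\<forall>e. ?W e \<subseteq> verts ?B \<and> complete_on (edge_rel ?B e) (?W e)"
    using complete_on_singleton_words by (auto simp: reduced_words_def)
  moreover have "?W False \<inter> ?W True = {}"
    by auto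
  moreover have "\<forall>e. |?W e| =o r"
    using ordIso_transitive[OF card_of_singleton_words A] by blast
  moreover have "|verts ?B| =o r"
    using card_of_reduced_words[OF r A] by simp
  ultimately have cliques:
    "\<exists>W :: bool \<Rightarrow> _. (\<forall>e. W e \<subseteq> verts ?B \<and> complete_on (edge_rel ?B e) (W e)) \<and>
        W False \<inter> W True = {} \<and> |verts ?B| =o r \<and> (\<forall>e. |W e| =o r)"
    by (intro exI[of _ ?W] conjI) assumption+
  have colourings: "\<exists>\<eta>. dom \<eta> = verts ?B \<and> respects_bigraph \<eta> ?B \<and> \<eta> a = Some e"
    if a: "a \<in> verts ?B" for a e
  proof -
    obtain f where f: "bigraph_automorphism ?B f" "f a = []"
      using automorphisms_link_Nil a by auto
    define \<theta> where "\<theta> w = (if w \<in> verts ?B then Some (head_colour e w) else None)" for w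
    have dom: "dom \<theta> = verts ?B"
      by (auto simp: \<theta>_def dom_def)
    have "respects_bigraph \<theta> ?B"
      using dom by (rule respects_head_colour[where c = e]) (simp add: \<theta>_def)
    with f(1) dom have "respects_bigraph (\<lambda>w. if w \<in> verts ?B then \<theta> (f w) else None) ?B"
      by (rule respects_bigraph_pullback)
    moreover have "dom (\<lambda>w. if w \<in> verts ?B then \<theta> (f w) else None) = verts ?B"
      using bigraph_automorphism_verts[OF f(1)] by (auto simp: \<theta>_def dom_def)
    ultimately show ?thesis
      using a f(2)
      by (intro exI[of _ "\<lambda>w. if w \<in> verts ?B then \<theta> (f w) else None"])
        (simp add: \<theta>_def head_colour_def)
  qed
  have "\<exists>f. bigraph_automorphism ?B f \<and> f a = b" if ab: "a \<in> verts ?B" "b \<in> verts ?B" for a b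
  proof -
    obtain f g where "bigraph_automorphism ?B f" "f a = []" "bigraph_automorphism ?B g" "g [] = b"
      using automorphisms_link_Nil[of a A] automorphisms_link_Nil[of b A] ab by auto
    then show ?thesis
      using bigraph_automorphism_comp[of ?B f g] by (intro exI[of _ "g \<circ> f"]) simp
  qed
  with cliques colourings show ?thesis
    unfolding suitable_bigraph_def using is_bigraph_word_bigraph by blast
qed

section \<open>Transport along injections\<close>

definition transport :: "('a \<Rightarrow> 'b) \<Rightarrow> 'a bigraph \<Rightarrow> 'b bigraph" where
  "transport \<phi> B =
     \<lparr>verts = \<phi> ` verts B, rel0 = map_prod \<phi> \<phi> ` rel0 B, rel1 = map_prod \<phi> \<phi> ` rel1 B\<rparr>"

lemma verts_transport [simp]: "verts (transport \<phi> B) = \<phi> ` verts B"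
  by (simp add: transport_def)

lemma edge_rel_transport: "edge_rel (transport \<phi> B) e = map_prod \<phi> \<phi> ` edge_rel B e"
  by (simp add: transport_def edge_rel_def)

lemma suitable_transport:
  fixes \<phi> :: "'a \<Rightarrow> 'b"
  assumes B: "suitable_bigraph r B" and inj: "inj_on \<phi> (verts B)"
  shows "suitable_bigraph r (transport \<phi> B)"
proof -
  let ?V = "verts B" and ?C = "transport \<phi> B"
  define \<psi> where "\<psi> = the_inv_into ?V \<phi>"
  have \<psi> [simp]: "\<psi> (\<phi> a) = a" if "a \<in> ?V" for a
    using that inj by (simp add: \<psi>_def the_inv_into_f_f)
  have bg: "is_bigraph B"
    using B by (simp add: suitable_bigraph_def)
  then have sub: "edge_rel B e \<subseteq> ?V \<times> ?V" for e
    by (simp add: is_bigraph_def)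
  have edge: "(\<phi> a, \<phi> b) \<in> edge_rel ?C e \<longleftrightarrow> (a, b) \<in> edge_rel B e" if "a \<in> ?V" "b \<in> ?V" for a b e
  proof
    assume "(\<phi> a, \<phi> b) \<in> edge_rel ?C e"
    then obtain c d where "(c, d) \<in> edge_rel B e" "\<phi> a = \<phi> c" "\<phi> b = \<phi> d"
      by (auto simp: edge_rel_transport)
    moreover from this have "a = c" "b = d"
      using that sub[of e] inj by (blast dest: inj_onD)+
    ultimately show "(a, b) \<in> edge_rel B e"
      by simp
  next
    assume "(a, b) \<in> edge_rel B e"
    then show "(\<phi> a, \<phi> b) \<in> edge_rel ?C e"
      using map_prod_imageI by (fastforce simp: edge_rel_transport)
  qed
  have subC: "edge_rel ?C e \<subseteq> \<phi> ` ?V \<times> \<phi> ` ?V" for e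
    using sub[of e] by (auto simp: edge_rel_transport)
  have "irrefl (edge_rel ?C e)" for e
  proof (rule irreflI, rule notI)
    fix x assume x: "(x, x) \<in> edge_rel ?C e"
    then obtain a where "a \<in> ?V" "x = \<phi> a"
      using subC[of e] by blast
    then show False
      using x bg edge by (auto simp: is_bigraph_def irrefl_def)
  qed
  moreover have "sym (edge_rel ?C e)" for e
    using bg by (auto simp: is_bigraph_def edge_rel_transport sym_def image_iff) force
  moreover have "edge_rel ?C False \<inter> edge_rel ?C True = {}"
  proof (rule equals0I)
    fix p assume p: "p \<in> edge_rel ?C False \<inter> edge_rel ?C True"
    then obtain a b where "a \<in> ?V" "b \<in> ?V" "p = (\<phi> a, \<phi> b)"
      using subC[of False] by blast
    then have "(a, b) \<in> edge_rel B False \<inter> edge_rel B True"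
      using p edge by simp
    then show False
      using bg by (auto simp: is_bigraph_def edge_rel_def)
  qed
  ultimately have bgC: "is_bigraph ?C"
    using subC by (simp add: is_bigraph_def edge_rel_def)
  have card: "|\<phi> ` U| =o |U|" if "U \<subseteq> ?V" for U
  proof -
    have "bij_betw \<phi> U (\<phi> ` U)"
      using inj that by (simp add: bij_betw_def inj_on_subset)
    then show ?thesis
      by (rule ordIso_symmetric[OF card_of_ordIsoI])
  qed
  obtain W :: "bool \<Rightarrow> 'a set" where
    "\<forall>e. W e \<subseteq> ?V \<and> complete_on (edge_rel B e) (W e)" "\<forall>e. |W e| =o r"
    and W_Int: "W False \<inter> W True = {}" and card_verts: "|?V| =o r"
    using B unfolding suitable_bigraph_def by (elim conjE exE)
  then have W: "W e \<subseteq> ?V" "complete_on (edge_rel B e) (W e)" "|W e| =o r" for e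
    by simp_all
  have cliques: "\<exists>W :: bool \<Rightarrow> 'b set.
      (\<forall>e. W e \<subseteq> verts ?C \<and> complete_on (edge_rel ?C e) (W e)) \<and>
      W False \<inter> W True = {} \<and> |verts ?C| =o r \<and> (\<forall>e. |W e| =o r)"
  proof (intro exI[of _ "\<lambda>e. \<phi> ` W e"] conjI allI)
    fix e
    show "\<phi> ` W e \<subseteq> verts ?C"
      using W(1) by auto
    have "(\<phi> a, \<phi> b) \<in> edge_rel ?C e" if "a \<in> W e" "b \<in> W e" "\<phi> a \<noteq> \<phi> b" for a b
    proof -
      have "(a, b) \<in> edge_rel B e"
        using that W(2)[of e] by (auto simp: complete_on_def)
      moreover have "a \<in> ?V" "b \<in> ?V"
        using that W(1) by blast+
      ultimately show ?thesis
        by (simp add: edge)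
    qed
    then show "complete_on (edge_rel ?C e) (\<phi> ` W e)"
      by (auto simp: complete_on_def)
    show "|\<phi> ` W e| =o r"
      by (rule ordIso_transitive[OF card[OF W(1)] W(3)])
  next
    show "\<phi> ` W False \<inter> \<phi> ` W True = {}"
      using inj_on_image_Int[OF inj W(1) W(1)] W_Int by (metis image_empty)
    show "|verts ?C| =o r"
      using ordIso_transitive[OF card[OF subset_refl] card_verts] by simp
  qed
  have colourings: "\<exists>\<eta>. dom \<eta> = verts ?C \<and> respects_bigraph \<eta> ?C \<and> \<eta> x = Some e"
    if x: "x \<in> verts ?C" for x e
  proof -
    obtain a where a: "a \<in> ?V" "x = \<phi> a"
      using x by auto
    obtain \<eta> where \<eta>: "dom \<eta> = ?V" "respects_bigraph \<eta> B" "\<eta> a = Some e"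
      using B a(1) unfolding suitable_bigraph_def by meson
    define \<theta> where "\<theta> y = (if y \<in> \<phi> ` ?V then \<eta> (\<psi> y) else None)" for y
    have \<theta>: "\<theta> (\<phi> b) = \<eta> b" if "b \<in> ?V" for b
      using that by (simp add: \<theta>_def)
    have dom: "dom \<theta> = \<phi> ` ?V"
    proof -
      have "y \<in> \<phi> ` ?V" if "y \<in> dom \<theta>" for y
        using that by (auto simp: \<theta>_def split: if_splits)
      moreover have "\<phi> b \<in> dom \<theta>" if "b \<in> ?V" for b
        using that \<eta>(1) \<theta> by (metis domIff)
      ultimately show ?thesis
        by blast
    qed
    have "respects_bigraph \<theta> ?C"
      using \<eta>(1,2) dom edge by (simp add: respects_bigraph_def \<theta>)
    then show ?thesis
      using dom \<theta> \<eta>(3) a by (intro exI[of _ \<theta>]) simp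
  qed
  have "\<exists>g. bigraph_automorphism ?C g \<and> g x = y" if xy: "x \<in> verts ?C" "y \<in> verts ?C" for x y
  proof -
    obtain a b where ab: "a \<in> ?V" "x = \<phi> a" "b \<in> ?V" "y = \<phi> b"
      using xy by auto
    then obtain f where f: "bigraph_automorphism B f" "f a = b"
      using B unfolding suitable_bigraph_def by meson
    define g where "g = \<phi> \<circ> f \<circ> \<psi>"
    have "bij_betw \<psi> (\<phi> ` ?V) ?V" "bij_betw \<phi> ?V (\<phi> ` ?V)"
      using inj by (simp_all add: \<psi>_def bij_betw_the_inv_into inj_on_imp_bij_betw)
    moreover have "bij_betw f ?V ?V"
      using f(1) by (simp add: bigraph_automorphism_def)
    ultimately have "bij_betw g (\<phi> ` ?V) (\<phi> ` ?V)"
      unfolding g_def by (metis bij_betw_trans)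
    moreover have "(\<phi> (f c), \<phi> (f d)) \<in> edge_rel ?C e \<longleftrightarrow> (\<phi> c, \<phi> d) \<in> edge_rel ?C e"
      if "c \<in> ?V" "d \<in> ?V" for c d e
      using that by (simp add: edge bigraph_automorphism_verts[OF f(1)]
          bigraph_automorphism_edge[OF f(1)])
    ultimately have "bigraph_automorphism ?C g"
      by (simp add: bigraph_automorphism_def g_def)
    then show ?thesis
      using ab f(2) by (auto simp: g_def)
  qed
  with bgC cliques colourings show ?thesis
    unfolding suitable_bigraph_def by blast
qed

theorem theorem2p6:
  fixes r :: "'a rel"
  assumes "Cinfinite r"
  shows "\<exists>B :: 'a bigraph. suitable_bigraph r B"
proof -
  have A: "|Field r| =o r"
    using assms card_of_Field_ordIso by blast
  have "|reduced_words ((UNIV :: bool set) \<times> Field r)| \<le>o |Field r|"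
    by (rule ordIso_imp_ordLeq[OF ordIso_transitive[OF card_of_reduced_words[OF assms A]
            ordIso_symmetric[OF A]]])
  then obtain \<phi> :: "(bool \<times> 'a) list \<Rightarrow> 'a" where "inj_on \<phi> (reduced_words (UNIV \<times> Field r))"
    by (auto simp flip: card_of_ordLeq)
  then show ?thesis
    using suitable_transport[OF suitable_word_bigraph[OF assms A]] by auto
qed

end
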